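(* Let $n\ge 1$ and let $a(s)=s^n+a_1s^{n-1}+\cdots+a_n$ and $b(s)=s^n+b_1s^{n-1}+\cdots+b_n$ be real polynomials of degree $n$ that are both Hurwitz stable. Then there exists a real polynomial $c(s)$ such that $c(s)/a(s)$ and $c(s)/b(s)$ are both strictly positive real if and only if $\lambda b(s)+(1-\lambda)a(s)$ is Hurwitz stable (of degree $n$) for every $\lambda\in[0,1]$.
   Context: A real polynomial is Hurwitz stable if all its roots lie in the open left half-plane $\mathrm{Re}[s]<0$. A rational function $f(s)=p(s)/q(s)$ with $p,q$ real polynomials is called strictly positive real (SPR) if (i) $\deg p=\deg q$; (ii) $q$ is Hurwitz stable (so $f$ is analytic in $\mathrm{Re}[s]\ge 0$); (iii) $\mathrm{Re}[f(j\omega)]>0$ for all $\omega\in\mathbb{R}$, where $j=\sqrt{-1}$. *)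

theory Defs
  imports "HOL-Analysis.Analysis" "HOL-Computational_Algebra.Polynomial"
begin

text \<open>A real polynomial is Hurwitz stable if all its (complex) roots lie in Re s < 0.
  The zero polynomial has every complex number as a root, so it is not Hurwitz stable.\<close>
definition hurwitz_stable :: "real poly \<Rightarrow> bool" where
  "hurwitz_stable p \<longleftrightarrow> (\<forall>z::complex. poly (map_poly complex_of_real p) z = 0 \<longrightarrow> Re z < 0)"

definition SPR :: "real poly \<Rightarrow> real poly \<Rightarrow> bool" where
  "SPR p q \<longleftrightarrow> degree p = degree q \<and> hurwitz_stable q \<and>
     (\<forall>w::real. Re (poly (map_poly complex_of_real p) (\<i> * complex_of_real w) /
                     poly (map_poly complex_of_real q) (\<i> * complex_of_real w)) > 0)"

end

theory Submission
  imports Defs "HOL-Complex_Analysis.Great_Picard" "HOL-Computational_Algebra.Field_as_Ring"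
    "HOL-Computational_Algebra.Fundamental_Theorem_Algebra"
    "HOL-Computational_Algebra.Polynomial_Factorial"
begin

text \<open>
  Strict positive realness of \<open>c/a\<close> says that \<open>c \<bullet> a > 0\<close> on the imaginary axis, where
  \<open>w \<bullet> z = Re (w cnj z)\<close> is the inner product of the plane; this is linear in \<open>a\<close> and in \<open>c\<close>. By
  the maximum principle the inequality extends to the right half-plane, so by linearity no member of
  the segment between \<open>a\<close> and \<open>b\<close> vanishes there. This is necessity.

  For sufficiency, let \<open>b\<^sub>l = l b + (1 - l) a\<close>. The set of \<open>l\<close> in \<open>[0, 1]\<close> for which \<open>a\<close> and \<open>b\<^sub>l\<close>
  have a common strict \<open>c\<close> contains \<open>0\<close> (take \<open>c = a\<close>), and from each of its points except \<open>1\<close> one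
  can move on to the right. It is also closed, hence contains \<open>1\<close>: a nonzero limit \<open>c\<close> of normalised
  solutions only satisfies the weak inequalities, but can be perturbed to a strict solution
  \<open>c + e d\<close>. The direction \<open>d\<close> has to point inwards wherever \<open>c \<bullet> a\<close> or \<open>c \<bullet> b\<^sub>l\<close> vanishes. As
  \<open>0\<close> is not on the line segment from \<open>a(s)\<close> to \<open>b\<^sub>l(s)\<close>, the vector \<open>v = sgn a + sgn b\<^sub>l\<close> points
  inwards, and so does every \<open>v + t c\<close> with \<open>t\<close> real at such a point. Now \<open>c = g h\<close> with \<open>g\<close>
  collecting the simple zeros on the axis and \<open>h\<close> Hurwitz stable. At the zeros of \<open>g\<close> the value of
  \<open>d\<close> is free. The other points are double zeros of nonnegative polynomials, so there are at most
  \<open>2 deg h\<close> of them, which is exactly the number of points at which \<open>Im (d\<^sub>1 cnj h)\<close> can be prescribed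
  by a real polynomial \<open>d\<^sub>1\<close> of degree at most \<open>deg h\<close>.
\<close>

section \<open>Real polynomials at complex points\<close>

definition ceval :: "real poly \<Rightarrow> complex \<Rightarrow> complex" where
  "ceval p z = poly (map_poly complex_of_real p) z"

lemma ceval_0 [simp]: "ceval 0 z = 0"
  by (simp add: ceval_def)

lemma ceval_pCons [simp]: "ceval (pCons c p) z = of_real c + z * ceval p z"
  by (simp add: ceval_def map_poly_pCons)

lemma ceval_monom [simp]: "ceval (monom c n) z = of_real c * z ^ n"
  by (simp add: ceval_def map_poly_monom poly_monom)

lemma ceval_smult [simp]: "ceval (smult c p) z = of_real c * ceval p z"
  by (simp add: ceval_def map_poly_smult)

lemma map_poly_of_real_add:
  "map_poly complex_of_real (p + q) = map_poly of_real p + map_poly of_real q"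
  by (simp add: poly_eq_iff coeff_map_poly)

lemma ceval_add [simp]: "ceval (p + q) z = ceval p z + ceval q z"
  by (simp add: ceval_def map_poly_of_real_add)

lemma ceval_minus [simp]: "ceval (- p) z = - ceval p z"
  using ceval_smult[of "-1" p z] by simp

lemma ceval_diff [simp]: "ceval (p - q) z = ceval p z - ceval q z"
  using ceval_add[of p "- q" z] by simp

lemma ceval_mult [simp]: "ceval (p * q) z = ceval p z * ceval q z"
  by (induction p) (simp_all add: algebra_simps)

lemma ceval_pcompose [simp]: "ceval (pcompose p q) z = ceval p (ceval q z)"
  by (induction p) (simp_all add: pcompose_pCons)

lemma ceval_of_real: "ceval p (of_real x) = of_real (poly p x)"
  by (induction p) simp_all

lemma ceval_cnj: "ceval p (cnj z) = cnj (ceval p z)"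
  by (induction p) simp_all

lemma ceval_altdef:
  assumes "degree p \<le> n"
  shows "ceval p z = (\<Sum>i\<le>n. of_real (coeff p i) * z ^ i)"
  unfolding ceval_def poly_altdef using assms
  by (auto simp: coeff_map_poly degree_map_poly intro!: le_degree sum.mono_neutral_left)

lemma continuous_on_ceval [continuous_intros]:
  "continuous_on S f \<Longrightarrow> continuous_on S (\<lambda>z. ceval p (f z))"
  unfolding ceval_def by (intro continuous_intros)

lemma holomorphic_on_ceval [holomorphic_intros]: "ceval p holomorphic_on S"
  unfolding ceval_def by (intro holomorphic_intros)

lemma finite_ceval_roots:
  assumes "p \<noteq> 0"
  shows "finite {z. ceval p z = 0}"
  unfolding ceval_def using assms by (intro poly_roots_finite) (simp add: map_poly_eq_0_iff)

lemma eq_0_if_card_ceval_roots: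
  assumes "p = 0 \<or> degree p < card S" "\<And>z. z \<in> S \<Longrightarrow> ceval p z = 0"
  shows "p = 0"
proof (rule ccontr)
  assume "p \<noteq> 0"
  then have "card S \<le> card {z. ceval p z = 0}"
    using assms(2) by (intro card_mono finite_ceval_roots) auto
  also have "\<dots> \<le> degree (map_poly complex_of_real p)"
    unfolding ceval_def using \<open>p \<noteq> 0\<close> by (intro card_poly_roots_bound) (simp add: map_poly_eq_0_iff)
  also have "\<dots> = degree p" by (simp add: degree_map_poly)
  finally show False using assms(1) \<open>p \<noteq> 0\<close> by simp
qed

lemma hurwitz_stable_iff_ceval: "hurwitz_stable p \<longleftrightarrow> (\<forall>z. Re z \<ge> 0 \<longrightarrow> ceval p z \<noteq> 0)"
  unfolding hurwitz_stable_def ceval_def by (metis not_le)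

lemma inner_complex_eq_Re_mult_cnj: "w \<bullet> z = Re (w * cnj z)" for w z :: complex
  by (simp add: inner_complex_def)

lemma ii_mult_of_real_Im_eq:
  assumes "Re z = 0"
  shows "\<i> * of_real (Im z) = z"
  using assms by (simp add: complex_eq_iff)

lemma SPR_iff_inner_pos:
  "SPR p q \<longleftrightarrow> degree p = degree q \<and> hurwitz_stable q \<and>
    (\<forall>z. Re z = 0 \<longrightarrow> ceval p z \<bullet> ceval q z > 0)"
proof -
  have "(\<forall>w. Re (ceval p (\<i> * of_real w) / ceval q (\<i> * of_real w)) > 0) \<longleftrightarrow>
      (\<forall>z. Re z = 0 \<longrightarrow> Re (ceval p z / ceval q z) > 0)"
    by (metis ii_mult_of_real_Im_eq Im_complex_of_real Re_i_times neg_equal_0_iff_equal)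
  then show ?thesis
    by (simp add: SPR_def ceval_def inner_complex_eq_Re_mult_cnj Re_complex_div_gt_0)
qed

definition positive_real :: "real poly \<Rightarrow> real poly \<Rightarrow> bool" where
  "positive_real p q \<longleftrightarrow> degree p \<le> degree q \<and> hurwitz_stable q \<and>
     (\<forall>z. Re z = 0 \<longrightarrow> ceval p z \<bullet> ceval q z \<ge> 0)"

section \<open>The right half-plane\<close>

lemma poly_divide_tendsto_at_infinity:
  fixes p q :: "'a::real_normed_field poly"
  assumes "degree p \<le> degree q" "q \<noteq> 0"
  shows "((\<lambda>z. poly p z / poly q z) \<longlongrightarrow> coeff p (degree q) / lead_coeff q) at_infinity"
proof -
  define k r where "k = coeff p (degree q) / lead_coeff q" and "r = p - smult k q"
  have "degree r < degree q \<or> r = 0"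
  proof (cases "degree q = 0")
    case True
    then show ?thesis using assms by (auto simp: r_def k_def elim!: degree_eq_zeroE)
  next
    case False
    have "degree r \<le> degree q"
      unfolding r_def using assms by (intro degree_diff_le order.trans[OF degree_smult_le]) auto
    moreover have "coeff r (degree q) = 0" using assms by (simp add: r_def k_def)
    ultimately show ?thesis using False eq_zero_or_degree_less by blast
  qed
  then have "((\<lambda>z. poly r z / poly q z) \<longlongrightarrow> 0) at_infinity"
    using poly_divide_tendsto_0_at_infinity by auto
  then have "((\<lambda>z. k + poly r z / poly q z) \<longlongrightarrow> k + 0) at_infinity"
    by (intro tendsto_intros)
  moreover have "\<forall>\<^sub>F z in at_infinity. k + poly r z / poly q z = poly p z / poly q z"
  proof -
    have "finite {z. poly q z = 0}" using assms(2) by (rule poly_roots_finite)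
    then have "bounded {z. poly q z = 0}" by (rule finite_imp_bounded)
    then obtain B where roots_bound: "\<And>z. poly q z = 0 \<Longrightarrow> norm z < B"
      unfolding bounded_pos_less by blast
    show ?thesis
    proof (rule eventually_at_infinityI)
      fix z :: 'a assume "norm z \<ge> B"
      then have "poly q z \<noteq> 0" using roots_bound[of z] by auto
      then show "k + poly r z / poly q z = poly p z / poly q z" by (simp add: r_def field_simps)
    qed
  qed
  ultimately show ?thesis unfolding k_def by (auto dest: tendsto_cong)
qed

lemma ceval_divide_tendsto_at_infinity:
  assumes "degree p \<le> degree q" "q \<noteq> 0"
  shows "((\<lambda>z. ceval p z / ceval q z) \<longlongrightarrow> of_real (coeff p (degree q) / lead_coeff q)) at_infinity"
  using poly_divide_tendsto_at_infinity[of "map_poly complex_of_real p" "map_poly of_real q"] assms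
  by (simp add: ceval_def degree_map_poly coeff_map_poly map_poly_eq_0_iff)

lemma tendsto_at_infinity_imaginary_axis_lowerbound:
  fixes f :: "complex \<Rightarrow> real"
  assumes "(f \<longlongrightarrow> L) at_infinity" "\<And>z. Re z = 0 \<Longrightarrow> m \<le> f z"
  shows "m \<le> L"
proof (rule tendsto_lowerbound)
  have "filterlim (\<lambda>y. \<i> * complex_of_real y) at_infinity at_top"
    by (intro tendsto_mult_filterlim_at_infinity[OF tendsto_const]
        filterlim_compose[OF filterlim_of_real_at_infinity filterlim_ident]) simp
  then show "((\<lambda>y. f (\<i> * of_real y)) \<longlongrightarrow> L) at_top"
    by (rule filterlim_compose[OF assms(1)])
  show "\<forall>\<^sub>F y in at_top. m \<le> f (\<i> * of_real y)"
    using assms(2) by simp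
qed simp

lemma frontier_right_half_disc:
  assumes "z \<in> frontier ({z. Re z \<ge> 0} \<inter> cball 0 r)"
  shows "Re z = 0 \<or> norm z = r"
proof (rule ccontr)
  assume contra: "\<not> (Re z = 0 \<or> norm z = r)"
  have "closed ({z. Re z \<ge> 0} \<inter> cball 0 r)"
    by (intro closed_Int closed_halfspace_Re_ge closed_cball)
  then have "z \<in> {z. Re z \<ge> 0} \<inter> cball 0 r"
    using assms frontier_subset_closed by blast
  then have "z \<in> {z. Re z > 0} \<inter> ball 0 r" using contra by auto
  moreover have "{z. Re z > 0} \<inter> ball 0 r \<subseteq> interior ({z. Re z \<ge> 0} \<inter> cball 0 r)"
    by (rule interior_maximal) (auto intro!: open_Int open_halfspace_Re_gt)
  ultimately show False using assms by (auto simp: frontier_def)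
qed

lemma Re_ge_right_half_plane:
  fixes f :: "complex \<Rightarrow> complex"
  assumes holo: "f holomorphic_on {z. Re z > 0}" and cont: "continuous_on {z. Re z \<ge> 0} f"
    and lim: "(f \<longlongrightarrow> L) at_infinity"
    and axis: "\<And>z. Re z = 0 \<Longrightarrow> m \<le> Re (f z)" and Re_s: "Re s \<ge> 0"
  shows "m \<le> Re (f s)"
proof (rule field_le_epsilon)
  fix e :: real assume "e > 0"
  have lim_Re: "((\<lambda>z. Re (f z)) \<longlongrightarrow> Re L) at_infinity"
    using lim by (intro tendsto_intros)
  have "m \<le> Re L"
    by (rule tendsto_at_infinity_imaginary_axis_lowerbound[OF lim_Re axis])
  then have "\<forall>\<^sub>F z in at_infinity. m - e < Re (f z)"
    using \<open>e > 0\<close> by (intro order_tendstoD(1)[OF lim_Re]) simp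
  then obtain R where far: "\<And>z. norm z \<ge> R \<Longrightarrow> m - e < Re (f z)"
    unfolding eventually_at_infinity by blast
  define r where "r = max R (norm s)"
  define S where "S = {z. Re z \<ge> 0} \<inter> cball 0 r"
  have "Re (- f s) \<le> e - m"
  proof (rule maximum_real_frontier[of "\<lambda>z. - f z" S])
    have "interior S \<subseteq> {z. Re z > 0}"
      using interior_halfspace_ge[of "1 :: complex" 0] by (auto simp: S_def)
    with holo show "(\<lambda>z. - f z) holomorphic_on interior S"
      by (intro holomorphic_intros) (rule holomorphic_on_subset)
    have "closed S"
      unfolding S_def by (intro closed_Int closed_halfspace_Re_ge closed_cball)
    with cont show "continuous_on (closure S) (\<lambda>z. - f z)"
      by (intro continuous_intros) (auto simp: S_def intro: continuous_on_subset)
    show "bounded S" unfolding S_def by (intro bounded_Int) simp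
    show "s \<in> S" using Re_s by (simp add: S_def r_def)
    fix z assume "z \<in> frontier S"
    then have "Re z = 0 \<or> norm z = r" unfolding S_def by (rule frontier_right_half_disc)
    then have "m - e \<le> Re (f z)"
      using axis[of z] far[of z] \<open>e > 0\<close> by (force simp: r_def)
    then show "Re (- f z) \<le> e - m" by simp
  qed
  then show "m \<le> Re (f s) + e" by simp
qed

lemma positive_real_inner_nonneg_right_half_plane:
  assumes "positive_real p q" "Re s \<ge> 0"
  shows "ceval p s \<bullet> ceval q s \<ge> 0"
proof -
  have q_nz: "ceval q z \<noteq> 0" if "Re z \<ge> 0" for z
    using assms(1) that by (simp add: positive_real_def hurwitz_stable_iff_ceval)
  from this[of 0] have "q \<noteq> 0" by auto
  have "0 \<le> Re (ceval p s / ceval q s)"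
  proof (rule Re_ge_right_half_plane[where f = "\<lambda>z. ceval p z / ceval q z"])
    show "(\<lambda>z. ceval p z / ceval q z) holomorphic_on {z. Re z > 0}"
      using q_nz by (intro holomorphic_intros) simp
    show "continuous_on {z. Re z \<ge> 0} (\<lambda>z. ceval p z / ceval q z)"
      using q_nz by (intro continuous_intros) simp
    show "((\<lambda>z. ceval p z / ceval q z) \<longlongrightarrow> of_real (coeff p (degree q) / lead_coeff q)) at_infinity"
      using assms(1) \<open>q \<noteq> 0\<close> by (intro ceval_divide_tendsto_at_infinity) (auto simp: positive_real_def)
    show "0 \<le> Re (ceval p z / ceval q z)" if "Re z = 0" for z
      using assms(1) that
      by (simp add: positive_real_def Re_complex_div_ge_0 inner_complex_eq_Re_mult_cnj)
  qed (use assms in simp)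
  then show ?thesis by (simp add: Re_complex_div_ge_0 inner_complex_eq_Re_mult_cnj)
qed

section \<open>Perturbation\<close>

lemma eventually_perturbation_pos_compact:
  fixes f g :: "'a::t2_space \<Rightarrow> real"
  assumes "compact K" and cont_f: "continuous_on K f" and cont_g: "continuous_on K g"
    and f_nonneg: "\<And>x. x \<in> K \<Longrightarrow> f x \<ge> 0" and g_pos: "\<And>x. x \<in> K \<Longrightarrow> f x = 0 \<Longrightarrow> g x > 0"
  shows "\<forall>\<^sub>F e in at_right 0. \<forall>x\<in>K. f x + e * g x > 0"
proof -
  define N where "N = K \<inter> g -` {..0}"
  have "compact N"
    unfolding N_def using \<open>compact K\<close> continuous_closedin_preimage[OF cont_g closed_atMost]
    by (rule closedin_compact)
  have cont_f_N: "continuous_on N f" using cont_f by (rule continuous_on_subset) (auto simp: N_def)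
  have "bounded (g ` K)"
    by (intro compact_imp_bounded compact_continuous_image cont_g \<open>compact K\<close>)
  then obtain B where g_bound: "B > 0" "\<And>x. x \<in> K \<Longrightarrow> \<bar>g x\<bar> \<le> B"
    unfolding bounded_pos by auto
  obtain m where f_bound: "m > 0" "\<And>x. x \<in> N \<Longrightarrow> m \<le> f x"
  proof (cases "N = {}")
    case False
    then obtain x where "x \<in> N" "\<And>y. y \<in> N \<Longrightarrow> f x \<le> f y"
      using continuous_attains_inf[OF \<open>compact N\<close> _ cont_f_N] by blast
    moreover from \<open>x \<in> N\<close> have "f x > 0"
      using f_nonneg[of x] g_pos[of x] by (force simp: N_def)
    ultimately show ?thesis using that by blast
  qed (use that[of 1] in auto)
  have "f x + e * g x > 0" if e: "0 < e" "e < m / B" and "x \<in> K" for e x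
  proof (cases "x \<in> N")
    case True
    have "\<bar>e * g x\<bar> \<le> e * B" using e g_bound(2)[OF \<open>x \<in> K\<close>] by (simp add: abs_mult)
    also have "\<dots> < m" using e g_bound(1) by (simp add: field_simps)
    also have "m \<le> f x" using f_bound(2) True .
    finally show ?thesis by linarith
  next
    case False
    then show ?thesis
      using \<open>x \<in> K\<close> \<open>0 < e\<close> f_nonneg by (auto simp: N_def intro: add_nonneg_pos)
  qed
  then show ?thesis
    using f_bound(1) g_bound(1) by (intro eventually_at_rightI[of 0 "m / B"]) auto
qed

lemma eventually_perturbation_pos_at_infinity:
  fixes f g :: "'a::real_normed_vector \<Rightarrow> real"
  assumes lim: "(f \<longlongrightarrow> L) at_infinity" "(g \<longlongrightarrow> M) at_infinity"
    and f_nonneg: "\<And>x. x \<in> K \<Longrightarrow> f x \<ge> 0"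
    and L_nonneg: "L \<ge> 0" and M_pos: "L = 0 \<Longrightarrow> M > 0"
  obtains R where "\<forall>\<^sub>F e in at_right 0. \<forall>x\<in>K. norm x \<ge> R \<longrightarrow> f x + e * g x > 0"
proof (cases "L = 0")
  case True
  have "\<forall>\<^sub>F x in at_infinity. g x > 0" using M_pos[OF True] by (rule order_tendstoD(1)[OF lim(2)])
  then obtain R where "\<And>x. norm x \<ge> R \<Longrightarrow> g x > 0" unfolding eventually_at_infinity by blast
  then have "\<forall>x\<in>K. norm x \<ge> R \<longrightarrow> f x + e * g x > 0" if "e > 0" for e
    using that f_nonneg by (auto intro: add_nonneg_pos)
  then have "\<forall>\<^sub>F e in at_right 0. \<forall>x\<in>K. norm x \<ge> R \<longrightarrow> f x + e * g x > 0"
    by (rule eventually_mono[OF eventually_at_right_less])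
  then show ?thesis by (rule that)
next
  case False
  define B where "B = \<bar>M\<bar> + 1"
  have "\<forall>\<^sub>F x in at_infinity. L / 2 < f x \<and> \<bar>g x\<bar> < B"
    using False L_nonneg unfolding B_def
    by (intro eventually_conj order_tendstoD(1)[OF lim(1)]
        order_tendstoD(2)[OF tendsto_rabs[OF lim(2)]]) auto
  then obtain R where far: "\<And>x. norm x \<ge> R \<Longrightarrow> L / 2 < f x \<and> \<bar>g x\<bar> < B"
    unfolding eventually_at_infinity by blast
  have "f x + e * g x > 0" if e: "0 < e" "e < L / 2 / B" and "norm x \<ge> R" for e x
  proof -
    have "\<bar>e * g x\<bar> \<le> e * B" using e far[OF \<open>norm x \<ge> R\<close>] by (simp add: abs_mult)
    also have "\<dots> < L / 2" using e by (simp add: B_def field_simps)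
    also have "L / 2 < f x" using far[OF \<open>norm x \<ge> R\<close>] by blast
    finally show ?thesis by linarith
  qed
  moreover have "L / 2 / B > 0" using False L_nonneg by (simp add: B_def)
  ultimately have "\<forall>\<^sub>F e in at_right 0. \<forall>x\<in>K. norm x \<ge> R \<longrightarrow> f x + e * g x > 0"
    by (intro eventually_at_rightI[of 0 "L / 2 / B"]) auto
  then show ?thesis by (rule that)
qed

lemma eventually_perturbation_pos_closed:
  fixes f g :: "'a::{real_normed_vector,heine_borel} \<Rightarrow> real"
  assumes "closed K" and cont_f: "continuous_on K f" and cont_g: "continuous_on K g"
    and lim: "(f \<longlongrightarrow> L) at_infinity" "(g \<longlongrightarrow> M) at_infinity"
    and f_nonneg: "\<And>x. x \<in> K \<Longrightarrow> f x \<ge> 0" and g_pos: "\<And>x. x \<in> K \<Longrightarrow> f x = 0 \<Longrightarrow> g x > 0"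
    and L_nonneg: "L \<ge> 0" and M_pos: "L = 0 \<Longrightarrow> M > 0"
  shows "\<forall>\<^sub>F e in at_right 0. \<forall>x\<in>K. f x + e * g x > 0"
proof -
  obtain R where "\<forall>\<^sub>F e in at_right 0. \<forall>x\<in>K. norm x \<ge> R \<longrightarrow> f x + e * g x > 0"
    using eventually_perturbation_pos_at_infinity[OF lim f_nonneg L_nonneg M_pos] by blast
  moreover have "\<forall>\<^sub>F e in at_right 0. \<forall>x\<in>K \<inter> cball 0 R. f x + e * g x > 0"
    using \<open>closed K\<close> cont_f cont_g f_nonneg g_pos
    by (intro eventually_perturbation_pos_compact closed_Int_compact)
      (auto intro: continuous_on_subset)
  ultimately show ?thesis
    by eventually_elim (metis IntI linear mem_cball_0)
qed

lemma eventually_degree_perturbation_eq: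
  fixes p d :: "real poly"
  assumes deg: "degree p \<le> n" "degree d \<le> n" and lead: "coeff p n = 0 \<Longrightarrow> coeff d n \<noteq> 0"
  shows "\<forall>\<^sub>F e in at_right 0. degree (p + smult e d) = n"
proof -
  have "\<forall>\<^sub>F e in at_right 0. coeff (p + smult e d) n \<noteq> 0"
  proof (cases "coeff p n = 0")
    case True
    then show ?thesis
      using lead eventually_mono[OF eventually_at_right_less[of "0::real"]] by auto
  next
    case False
    have "((\<lambda>e. coeff p n + e * coeff d n) \<longlongrightarrow> coeff p n + 0 * coeff d n) (at_right 0)"
      by (intro tendsto_intros)
    then show ?thesis using False by (auto dest: tendsto_imp_eventually_ne)
  qed
  then show ?thesis
  proof eventually_elim
    case (elim e)
    have "degree (p + smult e d) \<le> n"
      using deg by (intro degree_add_le order.trans[OF degree_smult_le])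
    then show ?case using elim by (simp add: le_degree antisym)
  qed
qed

lemma eventually_poly_perturbation_inner_pos:
  assumes q_nz: "\<And>z. Re z = 0 \<Longrightarrow> ceval q z \<noteq> 0"
    and deg: "degree p \<le> degree q" "degree d \<le> degree q"
    and nonneg: "\<And>z. Re z = 0 \<Longrightarrow> ceval p z \<bullet> ceval q z \<ge> 0"
    and pos: "\<And>z. Re z = 0 \<Longrightarrow> ceval p z \<bullet> ceval q z = 0 \<Longrightarrow> ceval d z \<bullet> ceval q z > 0"
    and lead: "coeff p (degree q) = 0 \<Longrightarrow> coeff d (degree q) * lead_coeff q > 0"
  shows "\<forall>\<^sub>F e in at_right 0. degree (p + smult e d) = degree q \<and>
    (\<forall>z. Re z = 0 \<longrightarrow> ceval (p + smult e d) z \<bullet> ceval q z > 0)"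
proof (rule eventually_conj)
  show "\<forall>\<^sub>F e in at_right 0. degree (p + smult e d) = degree q"
    using deg lead by (intro eventually_degree_perturbation_eq) auto
next
  have "q \<noteq> 0" using q_nz[of 0] by auto
  have inner_iff: "ceval r z \<bullet> ceval q z > 0 \<longleftrightarrow> Re (ceval r z / ceval q z) > 0"
    "ceval r z \<bullet> ceval q z = 0 \<longleftrightarrow> Re (ceval r z / ceval q z) = 0"
    "ceval r z \<bullet> ceval q z \<ge> 0 \<longleftrightarrow> Re (ceval r z / ceval q z) \<ge> 0" for r z
    by (simp_all add: inner_complex_eq_Re_mult_cnj Re_complex_div_gt_0 Re_complex_div_eq_0
        Re_complex_div_ge_0)
  have lim: "((\<lambda>z. Re (ceval r z / ceval q z)) \<longlongrightarrow> coeff r (degree q) / lead_coeff q) at_infinity"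
    if "degree r \<le> degree q" for r
    using tendsto_Re[OF ceval_divide_tendsto_at_infinity[OF that \<open>q \<noteq> 0\<close>]]
    by (simp only: Re_complex_of_real)
  have "\<forall>\<^sub>F e in at_right 0. \<forall>z\<in>{z. Re z = 0}.
      Re (ceval p z / ceval q z) + e * Re (ceval d z / ceval q z) > 0"
  proof (rule eventually_perturbation_pos_closed)
    show "closed {z. Re z = 0}" by (rule closed_halfspace_Re_eq)
    show "continuous_on {z. Re z = 0} (\<lambda>z. Re (ceval p z / ceval q z))"
      "continuous_on {z. Re z = 0} (\<lambda>z. Re (ceval d z / ceval q z))"
      using q_nz by (auto intro!: continuous_intros)
    show "coeff p (degree q) / lead_coeff q \<ge> 0"
      using nonneg by (intro tendsto_at_infinity_imaginary_axis_lowerbound[OF lim[OF deg(1)]])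
        (simp flip: inner_iff)
    show "coeff d (degree q) / lead_coeff q > 0" if "coeff p (degree q) / lead_coeff q = 0"
      using that lead \<open>q \<noteq> 0\<close> by (auto simp: zero_less_divide_iff zero_less_mult_iff)
  qed (use deg nonneg pos lim in \<open>simp_all flip: inner_iff\<close>)
  moreover have "ceval (p + smult e d) z / ceval q z =
      ceval p z / ceval q z + of_real e * (ceval d z / ceval q z)" for e z
    by (simp add: add_divide_distrib)
  ultimately show "\<forall>\<^sub>F e in at_right 0. \<forall>z. Re z = 0 \<longrightarrow> ceval (p + smult e d) z \<bullet> ceval q z > 0"
    by (simp add: inner_iff del: ceval_add ceval_smult times_divide_eq_right)
qed

lemma SPR_inner_pos_right_half_plane:
  assumes "SPR p q" "Re s \<ge> 0"
  shows "ceval p s \<bullet> ceval q s > 0"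
proof -
  have q_nz: "ceval q z \<noteq> 0" if "Re z \<ge> 0" for z
    using assms(1) that by (simp add: SPR_iff_inner_pos hurwitz_stable_iff_ceval)
  have inner: "ceval p z \<bullet> ceval q z > 0" if "Re z = 0" for z
    using assms(1) that by (simp add: SPR_iff_inner_pos)
  have deg: "degree p = degree q" using assms(1) by (simp add: SPR_def)
  have "p \<noteq> 0" using inner[of 0] by auto
  have "\<forall>\<^sub>F e in at_right 0. degree (p + smult e (- q)) = degree q \<and>
      (\<forall>z. Re z = 0 \<longrightarrow> ceval (p + smult e (- q)) z \<bullet> ceval q z > 0)"
  proof (rule eventually_poly_perturbation_inner_pos)
    show "ceval (- q) z \<bullet> ceval q z > 0" if "Re z = 0" "ceval p z \<bullet> ceval q z = 0" for z
      using that inner[of z] by simp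
    show "coeff (- q) (degree q) * lead_coeff q > 0" if "coeff p (degree q) = 0"
      using that \<open>p \<noteq> 0\<close> by (simp flip: deg)
  qed (use q_nz inner deg in \<open>simp_all add: less_imp_le\<close>)
  then have "\<forall>\<^sub>F e in at_right 0. e > 0 \<and> positive_real (p + smult e (- q)) q"
    using eventually_at_right_less[of 0]
    by eventually_elim (use assms(1) in \<open>auto simp: positive_real_def SPR_iff_inner_pos less_imp_le\<close>)
  then obtain e where e: "e > 0" "positive_real (p + smult e (- q)) q"
    using eventually_happens by force
  have "0 < e * (ceval q s \<bullet> ceval q s)" using e(1) q_nz[OF assms(2)] by simp
  also have "\<dots> \<le> ceval p s \<bullet> ceval q s"
    using positive_real_inner_nonneg_right_half_plane[OF e(2) assms(2)]
    by (simp add: inner_diff_left inner_mult_left)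
  finally show ?thesis .
qed

section \<open>Interpolation by real polynomials\<close>

lemma poly_interpolation_exists:
  fixes S :: "'a::field set"
  assumes "finite S"
  shows "\<exists>q. (q = 0 \<or> degree q < card S) \<and> (\<forall>x\<in>S. poly q x = f x)"
  using assms
proof (induction S rule: finite_induct)
  case empty
  show ?case by (intro exI[of _ 0]) simp
next
  case (insert x S)
  then obtain q where interp: "q = 0 \<or> degree q < card S" "\<And>y. y \<in> S \<Longrightarrow> poly q y = f y" by blast
  define M where "M = (\<Prod>y\<in>S. [:-y, 1:])"
  have deg_M: "degree M = card S" unfolding M_def by (subst degree_prod_eq_sum_degree) auto
  have M_roots: "poly M y = 0 \<longleftrightarrow> y \<in> S" for y
    using insert.hyps by (auto simp: M_def poly_prod)
  define r where "r = q + smult ((f x - poly q x) / poly M x) M"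
  have "degree r \<le> card S" unfolding r_def
    using interp(1) deg_M by (intro degree_add_le order.trans[OF degree_smult_le]) auto
  then have "degree r < card (insert x S)" using insert.hyps by simp
  moreover have "\<forall>y\<in>insert x S. poly r y = f y"
    using insert.hyps M_roots interp(2) by (auto simp: r_def)
  ultimately show ?case by blast
qed

lemma ceval_map_poly_Re: "ceval (map_poly Re q) z = (poly q z + cnj (poly q (cnj z))) / 2"
proof (induction q)
  case (pCons c q)
  have "of_real (Re c) = (c + cnj c) / 2" by (simp add: complex_add_cnj)
  then show ?case using pCons.IH by (simp add: map_poly_pCons field_simps)
qed simp

lemma real_poly_interpolation_exists:
  assumes "finite S" "\<And>z. z \<in> S \<Longrightarrow> cnj z \<in> S" "\<And>z. z \<in> S \<Longrightarrow> f (cnj z) = cnj (f z)"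
  obtains p where "p = 0 \<or> degree p < card S" "\<And>z. z \<in> S \<Longrightarrow> ceval p z = f z"
proof -
  obtain q where interp: "q = 0 \<or> degree q < card S" "\<And>z. z \<in> S \<Longrightarrow> poly q z = f z"
    using poly_interpolation_exists[OF assms(1)] by blast
  have "map_poly Re q = 0 \<or> degree (map_poly Re q) < card S"
    using interp(1) map_poly_degree_leq[of Re q] by auto
  moreover have "ceval (map_poly Re q) z = f z" if "z \<in> S" for z
    using that assms(2,3) interp(2) by (simp add: ceval_map_poly_Re)
  ultimately show ?thesis by (rule that)
qed

lemma coprime_reflection_if_hurwitz_stable:
  assumes "hurwitz_stable h"
  shows "coprime h (h \<circ>\<^sub>p [:0, -1:])"
proof (rule coprimeI)
  fix g assume dvd: "g dvd h" "g dvd h \<circ>\<^sub>p [:0, -1:]"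
  have "ceval h 0 \<noteq> 0" using assms by (simp add: hurwitz_stable_iff_ceval)
  then have "g \<noteq> 0" using dvd(1) by auto
  have "ceval g z \<noteq> 0" for z
  proof
    assume "ceval g z = 0"
    moreover obtain k l where "h = g * k" "h \<circ>\<^sub>p [:0, -1:] = g * l"
      using dvd by (auto elim!: dvdE)
    ultimately have "ceval h z = 0" "ceval (h \<circ>\<^sub>p [:0, -1:]) z = 0"
      by (simp_all only: ceval_mult mult_zero_left)
    then have "ceval h z = 0" "ceval h (- z) = 0" by simp_all
    then have "Re z < 0" "Re (- z) < 0"
      using assms by (auto simp: hurwitz_stable_iff_ceval not_le[symmetric])
    then show False by simp
  qed
  then have "constant (poly (map_poly complex_of_real g))"
    using Fundamental_Theorem_Algebra.fundamental_theorem_of_algebra[of "map_poly complex_of_real g"]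
    by (auto simp: ceval_def)
  then have "degree g = 0" by (simp add: constant_degree degree_map_poly)
  with \<open>g \<noteq> 0\<close> show "is_unit g" by (simp add: is_unit_iff_degree)
qed

lemma coprime_poly_combination_exists:
  fixes p q r :: "'a::field_gcd poly"
  assumes "coprime p q" "degree r < degree p + degree q" "p \<noteq> 0"
  obtains u v where "r = u * q + v * p" "u = 0 \<or> degree u < degree p" "v = 0 \<or> degree v < degree q"
proof -
  obtain x y where bezout: "x * p + y * q = 1"
    using bezout_coefficients_fst_snd[of p q] assms(1) by (auto simp: coprime_iff_gcd_eq_1)
  define u k where "u = (r * y) mod p" and "k = (r * y) div p"
  define v where "v = r * x + k * q"
  have division: "r * y = k * p + u" unfolding k_def u_def by (rule div_mult_mod_eq[symmetric])
  have "r = r * (x * p + y * q)" by (simp add: bezout)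
  also have "\<dots> = r * x * p + (r * y) * q" by (simp add: algebra_simps)
  also have "\<dots> = u * q + v * p" unfolding division by (simp add: v_def algebra_simps)
  finally have r_eq: "r = u * q + v * p" .
  have deg_u: "u = 0 \<or> degree u < degree p" unfolding u_def by (rule degree_mod_less[OF \<open>p \<noteq> 0\<close>])
  have "degree v < degree q" if "v \<noteq> 0"
  proof -
    have "degree (u * q) < degree p + degree q"
      using deg_u assms(2) degree_mult_le[of u q] by auto
    then have "degree (r - u * q) < degree p + degree q"
      using assms(2) by (intro degree_diff_less)
    moreover have "r - u * q = v * p" by (simp add: r_eq)
    ultimately show ?thesis using that \<open>p \<noteq> 0\<close> by (simp add: degree_mult_eq)
  qed
  then show ?thesis using r_eq deg_u that by blast
qed

text \<open>By a Bezout identity, \<open>r(s) = u(s) h(-s) + v(s) h(s)\<close>. On the imaginary axis \<open>h(-s)\<close> is the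
  conjugate of \<open>h(s)\<close>, and conjugating the second summand only changes the sign of its imaginary
  part.\<close>
lemma Im_mult_cnj_hurwitz_stable_exists:
  assumes stable: "hurwitz_stable h" and deg: "degree r < 2 * degree h"
  obtains d where "degree d \<le> degree h"
    "\<And>z. Re z = 0 \<Longrightarrow> Im (ceval d z * cnj (ceval h z)) = Im (ceval r z)"
proof -
  define h' where "h' = h \<circ>\<^sub>p [:0, -1:]"
  have deg_h': "degree h' = degree h" by (simp add: h'_def degree_pcompose)
  have "h \<noteq> 0" using deg by auto
  have "coprime h h'" unfolding h'_def by (rule coprime_reflection_if_hurwitz_stable[OF stable])
  moreover have "degree r < degree h + degree h'" using deg deg_h' by simp
  ultimately obtain u v where r_eq: "r = u * h' + v * h"
    and deg_uv: "u = 0 \<or> degree u < degree h" "v = 0 \<or> degree v < degree h'"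
    using coprime_poly_combination_exists[of h h' r] \<open>h \<noteq> 0\<close> by blast
  define d where "d = u - v \<circ>\<^sub>p [:0, -1:]"
  have "degree d \<le> degree h"
    unfolding d_def using deg_uv deg_h' by (intro degree_diff_le) (auto simp: degree_pcompose)
  moreover have "Im (ceval d z * cnj (ceval h z)) = Im (ceval r z)" if "Re z = 0" for z
  proof -
    have "- z = cnj z" using that by (simp add: complex_eq_iff)
    then have reflection: "ceval (p \<circ>\<^sub>p [:0, -1:]) z = cnj (ceval p z)" for p
      by (simp flip: ceval_cnj)
    have "Im (ceval d z * cnj (ceval h z)) =
        Im (ceval u z * cnj (ceval h z)) - Im (cnj (ceval v z * ceval h z))"
      unfolding d_def ceval_diff reflection by (simp add: algebra_simps)
    also have "\<dots> = Im (ceval r z)"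
      unfolding r_eq ceval_add ceval_mult h'_def reflection by simp
    finally show ?thesis .
  qed
  ultimately show ?thesis by (rule that)
qed

lemma hurwitz_stable_Im_interpolation_exists:
  fixes f :: "complex \<Rightarrow> real"
  assumes stable: "hurwitz_stable h" and "finite S" and card: "card S \<le> 2 * degree h"
    and axis: "\<And>z. z \<in> S \<Longrightarrow> Re z = 0" and cnj: "\<And>z. z \<in> S \<Longrightarrow> cnj z \<in> S"
    and odd: "\<And>z. z \<in> S \<Longrightarrow> f (cnj z) = - f z"
  obtains d where "degree d \<le> degree h" "\<And>z. z \<in> S \<Longrightarrow> Im (ceval d z * cnj (ceval h z)) = f z"
proof (cases "S = {}")
  case False
  obtain r where interp: "r = 0 \<or> degree r < card S" "\<And>z. z \<in> S \<Longrightarrow> ceval r z = \<i> * of_real (f z)"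
    using real_poly_interpolation_exists[of S "\<lambda>z. \<i> * of_real (f z)"] \<open>finite S\<close> cnj odd by auto
  have "card S > 0" using False \<open>finite S\<close> by (simp add: card_gt_0_iff)
  then have "degree r < 2 * degree h" using interp(1) card by auto
  then obtain d where "degree d \<le> degree h"
    "\<And>z. Re z = 0 \<Longrightarrow> Im (ceval d z * cnj (ceval h z)) = Im (ceval r z)"
    using Im_mult_cnj_hurwitz_stable_exists[OF stable] by blast
  then show ?thesis using that axis interp(2) by simp
qed (use that[of 0] in simp)

section \<open>Zeros of positive real functions\<close>

lemma root_in_right_half_plane:
  fixes w :: complex
  assumes "w \<noteq> 0" "k \<ge> 2"
  obtains z where "z ^ k = w" "Re z \<ge> 0"
proof
  show "exp (Ln w / of_nat k) ^ k = w"
    using assms exp_of_nat_mult[of k "Ln w / of_nat k"] by simp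
  have "\<bar>Im (Ln w)\<bar> \<le> pi"
    using Im_Ln_le_pi[OF assms(1)] mpi_less_Im_Ln[OF assms(1)] by simp
  also have "pi \<le> pi / 2 * real k"
    using assms(2) mult_left_mono[of 2 "real k" "pi / 2"] by simp
  finally have "\<bar>Im (Ln w / of_nat k)\<bar> \<le> pi / 2"
    using assms(2) by (simp add: field_simps)
  then show "Re (exp (Ln w / of_nat k)) \<ge> 0"
    unfolding Re_exp abs_le_iff by (intro mult_nonneg_nonneg cos_ge_zero) auto
qed

lemma Re_leading_term_nonneg:
  fixes g :: "complex \<Rightarrow> complex"
  assumes cont: "isCont g 0"
    and nonneg: "\<forall>\<^sub>F \<rho> in at_right 0. Re ((of_real \<rho> * z) ^ k * g (of_real \<rho> * z)) \<ge> 0"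
  shows "Re (z ^ k * g 0) \<ge> 0"
proof (rule tendsto_lowerbound)
  have "((\<lambda>\<rho>. of_real \<rho> * z) \<longlongrightarrow> of_real 0 * z) (at_right 0)"
    by (intro tendsto_intros)
  then have "((\<lambda>\<rho>. g (of_real \<rho> * z)) \<longlongrightarrow> g 0) (at_right 0)"
    by (intro isCont_tendsto_compose[OF cont]) simp
  then show "((\<lambda>\<rho>. Re (z ^ k * g (of_real \<rho> * z))) \<longlongrightarrow> Re (z ^ k * g 0)) (at_right 0)"
    by (intro tendsto_intros)
  show "\<forall>\<^sub>F \<rho> in at_right 0. 0 \<le> Re (z ^ k * g (of_real \<rho> * z))"
    using nonneg eventually_at_right_less[of 0]
  proof eventually_elim
    case (elim \<rho>)
    have "(of_real \<rho> * z) ^ k * g (of_real \<rho> * z) = of_real (\<rho> ^ k) * (z ^ k * g (of_real \<rho> * z))"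
      by (simp add: power_mult_distrib)
    then have "Re ((of_real \<rho> * z) ^ k * g (of_real \<rho> * z)) = \<rho> ^ k * Re (z ^ k * g (of_real \<rho> * z))"
      by (simp only: times_complex.sel Re_complex_of_real Im_complex_of_real mult_zero_left diff_zero)
    then show ?case using elim by (metis not_le zero_le_mult_iff zero_less_power)
  qed
qed simp

lemma Re_nonneg_near_0_imp_exponent_eq_0:
  fixes g :: "complex \<Rightarrow> complex"
  assumes cont: "isCont g 0" and g_nz: "g 0 \<noteq> 0" and nonneg: "\<forall>\<^sub>F v in at 0. Re (v ^ k * g v) \<ge> 0"
  shows "k = 0"
proof (rule ccontr)
  assume "k \<noteq> 0"
  then obtain z where z: "z ^ k = - inverse (g 0)"
    using exists_complex_root[of k "- inverse (g 0)"] by metis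
  have "z \<noteq> 0" using z g_nz \<open>k \<noteq> 0\<close> by (auto simp: power_0_left)
  have "filterlim (\<lambda>\<rho>. of_real \<rho> * z) (at 0) (at_right 0)"
    unfolding filterlim_at
    using \<open>z \<noteq> 0\<close> eventually_at_right_less[of 0]
    by (auto intro!: tendsto_eq_intros elim: eventually_mono)
  then have "Re (z ^ k * g 0) \<ge> 0"
    by (intro Re_leading_term_nonneg[OF cont] eventually_compose_filterlim[OF nonneg])
  then show False using z g_nz by simp
qed

lemma Re_nonneg_half_plane_imp_exponent_le_1:
  fixes g :: "complex \<Rightarrow> complex"
  assumes cont: "isCont g 0" and g_nz: "g 0 \<noteq> 0"
    and nonneg: "\<And>v. v \<noteq> 0 \<Longrightarrow> Re v \<ge> 0 \<Longrightarrow> Re (v ^ k * g v) \<ge> 0"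
  shows "k \<le> 1"
proof (rule ccontr)
  assume "\<not> k \<le> 1"
  then obtain z where z: "z ^ k = - inverse (g 0)" "Re z \<ge> 0"
    using root_in_right_half_plane[of "- inverse (g 0)" k] g_nz by auto
  have "z \<noteq> 0" using z(1) g_nz \<open>\<not> k \<le> 1\<close> by (auto simp: power_0_left)
  then have "Re (z ^ k * g 0) \<ge> 0"
    using z(2)
    by (intro Re_leading_term_nonneg[OF cont] eventually_mono[OF eventually_at_right_less] nonneg)
      auto
  then show False using z g_nz by simp
qed

lemma positive_real_zero_order:
  assumes pq: "positive_real p q" and "p \<noteq> 0" and Re_s: "Re s \<ge> 0"
  shows "order s (map_poly of_real p) \<le> (if Re s = 0 then 1 else 0)"
proof -
  define P where "P = map_poly complex_of_real p"
  define k where "k = order s P"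
  have "P \<noteq> 0" using \<open>p \<noteq> 0\<close> by (simp add: P_def map_poly_eq_0_iff)
  then obtain Q where P_eq: "P = [:- s, 1:] ^ k * Q" "\<not> [:- s, 1:] dvd Q"
    using order_decomp unfolding k_def by blast
  define g where "g v = poly Q (s + v) * cnj (ceval q (s + v))" for v
  have cont: "isCont g 0"
    unfolding g_def ceval_def by (intro continuous_intros)
  have "ceval q s \<noteq> 0"
    using pq Re_s by (simp add: positive_real_def hurwitz_stable_iff_ceval)
  then have g_nz: "g 0 \<noteq> 0" using P_eq(2) by (simp add: g_def poly_eq_0_iff_dvd)
  have "ceval p (s + v) = v ^ k * poly Q (s + v)" for v
    unfolding ceval_def P_def[symmetric] P_eq(1) by simp
  then have nonneg: "Re (v ^ k * g v) \<ge> 0" if "Re (s + v) \<ge> 0" for v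
    using positive_real_inner_nonneg_right_half_plane[OF pq that]
    by (simp add: g_def inner_complex_eq_Re_mult_cnj mult.assoc)
  show ?thesis
  proof (cases "Re s = 0")
    case True
    have "k \<le> 1"
      by (rule Re_nonneg_half_plane_imp_exponent_le_1[OF cont g_nz]) (use nonneg True in simp)
    then show ?thesis using True by (simp add: k_def P_def)
  next
    case False
    have "Re (v ^ k * g v) \<ge> 0" if "dist v 0 < Re s" for v
      using that abs_Re_le_cmod[of v] by (intro nonneg) simp
    then have "\<forall>\<^sub>F v in at 0. Re (v ^ k * g v) \<ge> 0"
      using False Re_s unfolding eventually_at by (intro exI[of _ "Re s"]) auto
    then have "k = 0" by (rule Re_nonneg_near_0_imp_exponent_eq_0[OF cont g_nz])
    then show ?thesis by (simp add: k_def P_def)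
  qed
qed

lemma positive_real_degree_le:
  assumes pq: "positive_real p q" and "p \<noteq> 0"
  shows "degree q \<le> degree p + 1"
proof -
  define m n where "m = degree p" and "n = degree q"
  have "m \<le> n" using pq by (simp add: positive_real_def m_def n_def)
  have "ceval q 0 \<noteq> 0" using pq by (simp add: positive_real_def hurwitz_stable_iff_ceval)
  define P Q where "P = map_poly complex_of_real p" and "Q = map_poly complex_of_real q"
  have deg: "degree P = m" "degree Q = n"
    by (simp_all add: P_def Q_def m_def n_def degree_map_poly)
  define g where "g v = poly (reflect_poly P) v * cnj (poly (reflect_poly Q) v)" for v
  have "n - m \<le> 1"
  proof (rule Re_nonneg_half_plane_imp_exponent_le_1)
    show "isCont g 0" unfolding g_def by (intro continuous_intros)
    show "g 0 \<noteq> 0"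
      using \<open>p \<noteq> 0\<close> \<open>ceval q 0 \<noteq> 0\<close> by (auto simp: g_def P_def Q_def map_poly_eq_0_iff)
    fix v :: complex assume v: "v \<noteq> 0" "Re v \<ge> 0"
    define c where "c = ceval p (inverse v) * cnj (ceval q (inverse v))"
    have "v ^ (n - m) * g v = v ^ n * cnj (v ^ n) * c"
      using v(1) \<open>m \<le> n\<close>
      by (simp add: g_def c_def poly_reflect_poly_nz deg ceval_def P_def[symmetric] Q_def[symmetric]
          mult_ac flip: power_add)
    also have "v ^ n * cnj (v ^ n) = of_real ((norm (v ^ n))\<^sup>2)"
      by (simp only: complex_norm_square)
    finally have "Re (v ^ (n - m) * g v) = (norm (v ^ n))\<^sup>2 * Re c"
      by (simp only: times_complex.sel Re_complex_of_real Im_complex_of_real mult_zero_left diff_zero)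
    moreover have "Re c \<ge> 0"
      using positive_real_inner_nonneg_right_half_plane[OF pq, of "inverse v"] v(2)
      by (simp add: c_def inner_complex_eq_Re_mult_cnj)
    ultimately show "Re (v ^ (n - m) * g v) \<ge> 0" by simp
  qed
  then show ?thesis by (simp add: m_def n_def)
qed

lemma monic_real_poly_vanishing_exists:
  assumes "finite S" "\<And>z. z \<in> S \<Longrightarrow> cnj z \<in> S"
  obtains g where "degree g = card S" "lead_coeff g = 1" "\<And>z. z \<in> S \<Longrightarrow> ceval g z = 0"
proof -
  obtain p where interp: "p = 0 \<or> degree p < card S" "\<And>z. z \<in> S \<Longrightarrow> ceval p z = z ^ card S"
    using real_poly_interpolation_exists[of S "\<lambda>z. z ^ card S"] assms by auto
  define g where "g = monom 1 (card S) - p"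
  have coeff: "coeff g (card S) = 1"
    using interp(1) by (auto simp: g_def coeff_eq_0)
  have "degree g \<le> card S"
    unfolding g_def using interp(1) by (intro degree_diff_le) (auto simp: degree_monom_le)
  with coeff have "degree g = card S" by (simp add: antisym le_degree)
  then show ?thesis using coeff interp(2) that[of g] by (simp add: g_def)
qed

lemma dvd_if_ceval_roots:
  assumes "g \<noteq> 0" "degree g = card S"
    and "\<And>z. z \<in> S \<Longrightarrow> ceval g z = 0" "\<And>z. z \<in> S \<Longrightarrow> ceval p z = 0"
  shows "g dvd p"
proof -
  have "p mod g = 0"
  proof (rule eq_0_if_card_ceval_roots)
    show "p mod g = 0 \<or> degree (p mod g) < card S"
      using degree_mod_less[OF assms(1)] assms(2) by simp
    fix z assume "z \<in> S"
    then have "ceval (p div g * g + p mod g) z = 0" using assms(4) by simp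
    then show "ceval (p mod g) z = 0"
      using assms(3)[OF \<open>z \<in> S\<close>] by (simp only: ceval_add ceval_mult) simp
  qed
  then show ?thesis by (simp add: dvd_eq_mod_eq_0)
qed

definition imaginary_zeros :: "real poly \<Rightarrow> complex set" where
  "imaginary_zeros p = {z. Re z = 0 \<and> ceval p z = 0}"

lemma cnj_in_imaginary_zeros: "z \<in> imaginary_zeros p \<Longrightarrow> cnj z \<in> imaginary_zeros p"
  by (simp add: imaginary_zeros_def ceval_cnj)

lemma finite_imaginary_zeros: "p \<noteq> 0 \<Longrightarrow> finite (imaginary_zeros p)"
  unfolding imaginary_zeros_def by (rule finite_subset[OF _ finite_ceval_roots]) auto

lemma map_poly_of_real_mult:
  "map_poly complex_of_real (p * q) = map_poly of_real p * map_poly of_real q"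
  unfolding poly_eq_poly_eq_iff[symmetric]
  using ceval_mult[of p q] by (auto simp: ceval_def fun_eq_iff)

lemma positive_real_factorization:
  assumes pq: "positive_real p q" and "p \<noteq> 0"
  obtains g h where "p = g * h" "hurwitz_stable h" "degree g = card (imaginary_zeros p)"
    "\<And>z. z \<in> imaginary_zeros p \<Longrightarrow> ceval g z = 0"
proof -
  define W where "W = imaginary_zeros p"
  obtain g where vanishing: "degree g = card W" "lead_coeff g = 1" "\<And>z. z \<in> W \<Longrightarrow> ceval g z = 0"
    using monic_real_poly_vanishing_exists[of W] finite_imaginary_zeros[OF \<open>p \<noteq> 0\<close>]
      cnj_in_imaginary_zeros unfolding W_def by blast
  have "g dvd p"
    using vanishing by (intro dvd_if_ceval_roots[of g W]) (auto simp: W_def imaginary_zeros_def)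
  then obtain h where p_eq: "p = g * h" by (elim dvdE)
  have "hurwitz_stable h"
    unfolding hurwitz_stable_iff_ceval
  proof (intro allI impI notI)
    fix z assume z: "Re z \<ge> 0" "ceval h z = 0"
    define P G H where "P = map_poly complex_of_real p"
      and "G = map_poly complex_of_real g" and "H = map_poly complex_of_real h"
    have "P \<noteq> 0" using \<open>p \<noteq> 0\<close> by (simp add: P_def map_poly_eq_0_iff)
    moreover have "P = G * H" by (simp add: P_def G_def H_def p_eq map_poly_of_real_mult)
    ultimately have order: "order z P = order z G + order z H" "G \<noteq> 0" "H \<noteq> 0"
      by (auto simp: order_mult)
    have "order z H > 0" using z(2) order(3) by (simp add: order_gt_0_iff ceval_def H_def)
    moreover have "order z P \<le> (if Re z = 0 then 1 else 0)"
      unfolding P_def by (rule positive_real_zero_order[OF assms z(1)])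
    ultimately have "Re z = 0" "order z G = 0"
      using order(1) by (auto split: if_splits)
    moreover have "ceval g z = 0"
      using \<open>Re z = 0\<close> z(2) by (intro vanishing(3)) (simp add: W_def imaginary_zeros_def p_eq)
    ultimately show False using order(2) by (simp add: order_eq_0_iff ceval_def G_def)
  qed
  then show ?thesis using that p_eq vanishing unfolding W_def by blast
qed

section \<open>Counting zeros on the imaginary axis\<close>

definition axis_Re :: "real poly \<Rightarrow> real poly" where
  "axis_Re p = map_poly Re (map_poly of_real p \<circ>\<^sub>p [:0, \<i>:])"

lemma poly_axis_Re: "poly (axis_Re p) w = Re (ceval p (\<i> * of_real w))"
proof -
  define q where "q = map_poly complex_of_real p \<circ>\<^sub>p [:0, \<i>:]"
  have "poly (map_poly Re q) w = Re (poly q (of_real w))"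
    by (induction q) (simp_all add: map_poly_pCons)
  then show ?thesis by (simp add: axis_Re_def q_def ceval_def poly_pcompose mult.commute)
qed

lemma coeff_axis_Re: "coeff (axis_Re p) k = Re (\<i> ^ k) * coeff p k"
  by (simp add: axis_Re_def coeff_map_poly coeff_pcompose_linear)

lemma degree_axis_Re_le:
  assumes "degree p \<le> 2 * m + 1"
  shows "degree (axis_Re p) \<le> 2 * m"
proof (rule degree_le, intro allI impI)
  fix k assume k: "2 * m < k"
  show "coeff (axis_Re p) k = 0"
  proof (cases "k = 2 * m + 1")
    case True
    have "\<i> ^ k = \<i> * of_real ((- 1) ^ m)" by (simp add: True power_mult)
    then have "Re (\<i> ^ k) = 0" by (simp only: Re_i_times Im_complex_of_real minus_zero)
    then show ?thesis by (simp add: coeff_axis_Re)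
  next
    case False
    then show ?thesis using k assms by (simp add: coeff_axis_Re coeff_eq_0)
  qed
qed

lemma two_card_roots_le_degree_if_nonneg:
  fixes P :: "real poly"
  assumes "P \<noteq> 0" "\<And>x. poly P x \<ge> 0"
  shows "2 * card {x. poly P x = 0} \<le> degree P"
proof -
  have "order x P \<ge> 2" if root: "poly P x = 0" for x
  proof -
    have "poly (pderiv P) x = 0"
      by (rule DERIV_local_min[OF poly_DERIV, of 1]) (use root assms(2) in auto)
    moreover have "pderiv P \<noteq> 0"
      using order_gt_0_iff[OF \<open>P \<noteq> 0\<close>, of x] order_degree[OF \<open>P \<noteq> 0\<close>, of x] root
      by (simp add: pderiv_eq_0_iff)
    ultimately have "order x (pderiv P) \<noteq> 0" by (simp add: order_root)
    then show ?thesis using order_pderiv[OF \<open>P \<noteq> 0\<close> root] by simp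
  qed
  then have "(\<Sum>x | poly P x = 0. 2) \<le> (\<Sum>x | poly P x = 0. order x P)"
    by (intro sum_mono) simp
  also have "\<dots> = size (proots P)"
    using \<open>P \<noteq> 0\<close> by (simp add: size_multiset_overloaded_eq)
  also have "\<dots> \<le> degree P" by (rule size_proots_le)
  finally show ?thesis by simp
qed

lemma eq_0_if_inner_ceval_eq_0_on_axis:
  assumes deg: "degree p \<le> degree q" and stable: "hurwitz_stable q"
    and inner: "\<And>z. Re z = 0 \<Longrightarrow> ceval p z \<bullet> ceval q z = 0"
  shows "p = 0"
proof (rule ccontr)
  assume "p \<noteq> 0"
  have pr: "positive_real p q" "positive_real (- p) q"
    using deg stable inner by (simp_all add: positive_real_def)
  have "ceval p (of_real x) = 0" if "x \<ge> 0" for x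
  proof -
    have "ceval p (of_real x) \<bullet> ceval q (of_real x) = 0"
      using positive_real_inner_nonneg_right_half_plane[OF pr(1), of "of_real x"]
        positive_real_inner_nonneg_right_half_plane[OF pr(2), of "of_real x"] that by simp
    moreover have "ceval q (of_real x) \<noteq> 0"
      using stable that by (simp add: hurwitz_stable_iff_ceval)
    ultimately show ?thesis by (simp add: ceval_of_real inner_complex_def)
  qed
  then have "complex_of_real ` {0..} \<subseteq> {z. ceval p z = 0}" by auto
  then have "finite (complex_of_real ` {0..})"
    using finite_ceval_roots[OF \<open>p \<noteq> 0\<close>] finite_subset by blast
  then have "finite {0 :: real..}" by (rule finite_imageD) (simp add: inj_on_def)
  then show False using infinite_Ici by blast
qed

definition inner_zeros :: "real poly \<Rightarrow> real poly \<Rightarrow> complex set" where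
  "inner_zeros p q = {z. Re z = 0 \<and> ceval p z \<bullet> ceval q z = 0}"

lemma imaginary_zeros_subset_inner_zeros: "imaginary_zeros p \<subseteq> inner_zeros p q"
  by (auto simp: imaginary_zeros_def inner_zeros_def)

lemma positive_real_card_inner_zeros:
  assumes pq: "positive_real p q" and "p \<noteq> 0"
  shows "finite (inner_zeros p q)" "card (inner_zeros p q) \<le> degree p"
proof -
  define P where "P = axis_Re (p * (q \<circ>\<^sub>p [:0, -1:]))"
  have poly_P: "poly P w = ceval p (\<i> * of_real w) \<bullet> ceval q (\<i> * of_real w)" for w
    using ceval_cnj[of q "\<i> * of_real w"]
    by (simp add: P_def poly_axis_Re inner_complex_eq_Re_mult_cnj)
  have "P \<noteq> 0"
  proof
    assume "P = 0"
    then have "ceval p z \<bullet> ceval q z = 0" if "Re z = 0" for z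
      using poly_P[of "Im z"] ii_mult_of_real_Im_eq[OF that] by simp
    then show False
      using eq_0_if_inner_ceval_eq_0_on_axis pq \<open>p \<noteq> 0\<close> by (auto simp: positive_real_def)
  qed
  have inner_zeros_eq: "inner_zeros p q = (\<lambda>w. \<i> * of_real w) ` {w. poly P w = 0}"
    unfolding inner_zeros_def poly_P by (auto simp: image_iff) (metis ii_mult_of_real_Im_eq)
  show "finite (inner_zeros p q)"
    unfolding inner_zeros_eq using \<open>P \<noteq> 0\<close> by (intro finite_imageI poly_roots_finite)
  have "degree (p * (q \<circ>\<^sub>p [:0, -1:])) \<le> degree p + degree q"
    using degree_mult_le[of p "q \<circ>\<^sub>p [:0, -1:]"] by (simp add: degree_pcompose)
  then have "degree P \<le> 2 * degree p"
    unfolding P_def using positive_real_degree_le[OF pq \<open>p \<noteq> 0\<close>] by (intro degree_axis_Re_le) simp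
  moreover have "2 * card {w. poly P w = 0} \<le> degree P"
    using pq
    by (intro two_card_roots_le_degree_if_nonneg[OF \<open>P \<noteq> 0\<close>]) (simp add: poly_P positive_real_def)
  moreover have "card (inner_zeros p q) = card {w. poly P w = 0}"
    unfolding inner_zeros_eq by (intro card_image) (simp add: inj_on_def)
  ultimately show "card (inner_zeros p q) \<le> degree p" by simp
qed

section \<open>From weak to strict positivity\<close>

lemma Im_mult_cnj_mult: "Im ((x * y) * cnj (x * z)) = (norm x)\<^sup>2 * Im (y * cnj z)"
proof -
  have "(x * y) * cnj (x * z) = of_real ((norm x)\<^sup>2) * (y * cnj z)"
    by (simp add: complex_norm_square mult_ac del: of_real_power)
  then show ?thesis
    by (simp only: times_complex.sel(2)[of "of_real _"] Re_complex_of_real Im_complex_of_real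
        mult_zero_left add_0_right)
qed

lemma real_multiple_if_Im_mult_cnj_eq_0:
  assumes "Im (w * cnj z) = 0" "z \<noteq> 0"
  obtains t :: real where "w = of_real t * z"
proof -
  have "w / z \<in> \<real>"
    using assms(1) by (simp only: complex_is_Real_iff Im_complex_div_eq_0)
  then obtain t where "w / z = of_real t" by (elim Reals_cases)
  then have "w = of_real t * z" using assms(2) by (simp add: field_simps)
  then show ?thesis by (rule that)
qed

text \<open>Prescribing \<open>d\<close> only up to real multiples of \<open>c\<close> costs one real condition per point of \<open>T\<close>
  instead of two; this is why \<open>T\<close> may have twice as many points as the degree would suggest.\<close>
lemma positive_real_direction_exists:
  assumes pr: "positive_real c a" and "c \<noteq> 0"
    and T: "finite T" "card T \<le> 2 * (degree c - card (imaginary_zeros c))"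
      "\<And>z. z \<in> T \<Longrightarrow> Re z = 0" "\<And>z. z \<in> T \<Longrightarrow> cnj z \<in> T"
    and T_nz: "\<And>z. z \<in> T \<Longrightarrow> ceval c z \<noteq> 0"
    and v_cnj: "\<And>z. v (cnj z) = cnj (v z)"
  obtains d where "degree d \<le> degree c"
    "\<And>z. z \<in> imaginary_zeros c \<union> T \<Longrightarrow> \<exists>t::real. ceval d z = v z + of_real t * ceval c z"
proof -
  define W where "W = imaginary_zeros c"
  obtain g h where c_eq: "c = g * h" and "hurwitz_stable h" and deg_g: "degree g = card W"
    and g_zero: "\<And>z. z \<in> W \<Longrightarrow> ceval g z = 0"
    using positive_real_factorization[OF pr \<open>c \<noteq> 0\<close>] unfolding W_def by blast
  have "g \<noteq> 0" "h \<noteq> 0" using c_eq \<open>c \<noteq> 0\<close> by auto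
  then have deg_c: "degree c = card W + degree h" by (simp add: c_eq deg_g degree_mult_eq)
  obtain p where deg_p: "p = 0 \<or> degree p < card W" and p_W: "\<And>z. z \<in> W \<Longrightarrow> ceval p z = v z"
    using real_poly_interpolation_exists[of W v] v_cnj
      finite_imaginary_zeros[OF \<open>c \<noteq> 0\<close>] cnj_in_imaginary_zeros
    unfolding W_def by blast
  define f where "f z = Im ((v z - ceval p z) * cnj (ceval c z)) / (norm (ceval g z))\<^sup>2" for z
  have "f (cnj z) = - f z" for z
    unfolding f_def v_cnj ceval_cnj complex_cnj_diff[symmetric] complex_cnj_mult[symmetric]
    by (simp only: cnj.sel(2) minus_divide_left complex_mod_cnj)
  moreover have "card T \<le> 2 * degree h" using T(2) deg_c by (simp add: W_def)
  ultimately obtain e where deg_e: "degree e \<le> degree h"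
    and e_T: "\<And>z. z \<in> T \<Longrightarrow> Im (ceval e z * cnj (ceval h z)) = f z"
    using hurwitz_stable_Im_interpolation_exists[OF \<open>hurwitz_stable h\<close> T(1) _ T(3,4), of f] by blast
  define d where "d = p + g * e"
  have "degree d \<le> degree c"
    unfolding d_def using deg_p deg_e deg_c deg_g
    by (intro degree_add_le order.trans[OF degree_mult_le]) auto
  moreover have "\<exists>t::real. ceval d z = v z + of_real t * ceval c z" if "z \<in> W" for z
    using that by (intro exI[of _ 0]) (simp add: d_def p_W g_zero)
  moreover have "\<exists>t::real. ceval d z = v z + of_real t * ceval c z" if "z \<in> T" for z
  proof -
    have "ceval c z \<noteq> 0" by (rule T_nz[OF that])
    then have "ceval g z \<noteq> 0" by (simp add: c_eq)
    have "Im (ceval (g * e) z * cnj (ceval c z)) = (norm (ceval g z))\<^sup>2 * f z"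
      unfolding c_eq ceval_mult Im_mult_cnj_mult e_T[OF that] ..
    also have "\<dots> = Im ((v z - ceval p z) * cnj (ceval c z))"
      using \<open>ceval g z \<noteq> 0\<close> by (simp add: f_def del: times_complex.sel)
    finally have "Im ((ceval d z - v z) * cnj (ceval c z)) = 0"
      by (simp add: d_def algebra_simps)
    then obtain t where "ceval d z - v z = of_real t * ceval c z"
      using \<open>ceval c z \<noteq> 0\<close> by (rule real_multiple_if_Im_mult_cnj_eq_0)
    then show ?thesis by (intro exI[of _ t]) (simp add: algebra_simps)
  qed
  ultimately show ?thesis using that unfolding W_def by blast
qed

lemma inner_sgn_add_sgn_pos:
  fixes x y :: "'a::real_inner"
  assumes "0 \<notin> closed_segment x y"
  shows "(sgn x + sgn y) \<bullet> x > 0"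
proof -
  have nz: "x \<noteq> 0" "y \<noteq> 0" using assms by auto
  then have sgn_self: "sgn x \<bullet> sgn x = 1" "sgn y \<bullet> sgn y = 1"
    by (simp_all add: dot_square_norm norm_sgn)
  have polar: "norm x *\<^sub>R sgn x = x" "norm y *\<^sub>R sgn y = y"
    using nz by (simp_all add: sgn_div_norm)
  have "sgn x + sgn y \<noteq> 0"
  proof
    assume sgn_sum: "sgn x + sgn y = 0"
    define u where "u = norm x / (norm x + norm y)"
    have "norm x + norm y > 0" using nz by (simp add: add_pos_pos)
    then have "1 - u = norm y / (norm x + norm y)" by (simp add: u_def field_simps)
    then have "(1 - u) *\<^sub>R (norm x *\<^sub>R sgn x) + u *\<^sub>R (norm y *\<^sub>R sgn y) =
        (norm x * norm y / (norm x + norm y)) *\<^sub>R (sgn x + sgn y)"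
      by (simp add: u_def scaleR_add_right mult.commute)
    then have "0 = (1 - u) *\<^sub>R x + u *\<^sub>R y" by (simp add: sgn_sum polar)
    moreover have "0 \<le> u" "u \<le> 1" using \<open>norm x + norm y > 0\<close> by (simp_all add: u_def)
    ultimately show False using assms unfolding in_segment(1) by blast
  qed
  then have "0 < (sgn x + sgn y) \<bullet> (sgn x + sgn y)" by simp
  also have "\<dots> = 2 * (1 + sgn x \<bullet> sgn y)"
    by (simp add: sgn_self inner_add inner_commute)
  finally have "0 < norm x * (1 + sgn x \<bullet> sgn y)" using nz by simp
  also have "\<dots> = (sgn x + sgn y) \<bullet> (norm x *\<^sub>R sgn x)"
    by (simp add: sgn_self inner_add_left inner_commute algebra_simps)
  finally show ?thesis unfolding polar .
qed

text \<open>The monomial makes the perturbation positive at infinity as well; its finite values are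
  compensated in the direction \<open>d\<close>.\<close>
lemma eventually_SPR_perturbation:
  assumes pr: "positive_real c a" and "c \<noteq> 0" and lead: "lead_coeff a > 0" and "degree d \<le> degree c"
    and v_pos: "\<And>z. Re z = 0 \<Longrightarrow> v z \<bullet> ceval a z > 0"
    and direction: "\<And>z. z \<in> inner_zeros c a \<Longrightarrow>
      \<exists>t::real. ceval d z = (v z - z ^ degree a) + of_real t * ceval c z"
  shows "\<forall>\<^sub>F e in at_right 0. SPR (c + smult e (monom 1 (degree a) + d)) a"
proof -
  define d' where "d' = monom 1 (degree a) + d"
  have "degree c \<le> degree a" using pr by (simp add: positive_real_def)
  have "\<forall>\<^sub>F e in at_right 0. degree (c + smult e d') = degree a \<and>
      (\<forall>z. Re z = 0 \<longrightarrow> ceval (c + smult e d') z \<bullet> ceval a z > 0)"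
  proof (rule eventually_poly_perturbation_inner_pos)
    show "degree d' \<le> degree a"
      unfolding d'_def using \<open>degree d \<le> degree c\<close> \<open>degree c \<le> degree a\<close>
      by (intro degree_add_le) (auto simp: degree_monom_le)
    show "coeff d' (degree a) * lead_coeff a > 0" if "coeff c (degree a) = 0"
    proof -
      have "degree c < degree a"
        using that \<open>degree c \<le> degree a\<close> \<open>c \<noteq> 0\<close> by (metis leading_coeff_0_iff le_neq_implies_less)
      then show ?thesis using lead \<open>degree d \<le> degree c\<close> by (simp add: d'_def coeff_eq_0)
    qed
    show "ceval d' z \<bullet> ceval a z > 0" if z: "Re z = 0" "ceval c z \<bullet> ceval a z = 0" for z
    proof -
      obtain t :: real where "ceval d z = (v z - z ^ degree a) + of_real t * ceval c z"
        using direction z by (auto simp: inner_zeros_def)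
      then have "ceval d' z \<bullet> ceval a z = v z \<bullet> ceval a z"
        using z(2) by (simp add: d'_def inner_add_left inner_mult_left)
      then show ?thesis using v_pos[OF z(1)] by simp
    qed
  qed (use pr in \<open>auto simp: positive_real_def hurwitz_stable_iff_ceval\<close>)
  then show ?thesis
    using pr by (simp add: SPR_iff_inner_pos positive_real_def d'_def)
qed

lemma positive_real_common_imp_SPR_common:
  assumes "c \<noteq> 0" and pr: "positive_real c a" "positive_real c b"
    and deg: "degree b = degree a" and lead: "lead_coeff a > 0" "lead_coeff b > 0"
    and segment: "\<And>z. Re z = 0 \<Longrightarrow> 0 \<notin> closed_segment (ceval a z) (ceval b z)"
  obtains c' where "SPR c' a" "SPR c' b"
proof -
  define n where "n = degree a"
  define T where "T = (inner_zeros c a \<union> inner_zeros c b) - imaginary_zeros c"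
  define v where "v z = sgn (ceval a z) + sgn (ceval b z)" for z
  have v_pos: "v z \<bullet> ceval a z > 0" "v z \<bullet> ceval b z > 0" if "Re z = 0" for z
    using inner_sgn_add_sgn_pos[of "ceval a z" "ceval b z"]
      inner_sgn_add_sgn_pos[of "ceval b z" "ceval a z"] segment[OF that]
    by (simp_all add: v_def closed_segment_commute add.commute)
  have v_cnj: "v (cnj z) - cnj z ^ n = cnj (v z - z ^ n)" for z
    by (simp add: v_def ceval_cnj sgn_eq)
  have "finite T" using positive_real_card_inner_zeros(1) pr \<open>c \<noteq> 0\<close> by (simp add: T_def)
  have card_diff: "card (inner_zeros c x - imaginary_zeros c) \<le> degree c - card (imaginary_zeros c)"
    if "positive_real c x" for x
    using positive_real_card_inner_zeros(2)[OF that \<open>c \<noteq> 0\<close>] finite_imaginary_zeros[OF \<open>c \<noteq> 0\<close>]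
    by (simp add: card_Diff_subset imaginary_zeros_subset_inner_zeros diff_le_mono)
  have "card T \<le> card (inner_zeros c a - imaginary_zeros c) +
      card (inner_zeros c b - imaginary_zeros c)"
    unfolding T_def Un_Diff by (rule card_Un_le)
  then have "card T \<le> 2 * (degree c - card (imaginary_zeros c))"
    using card_diff[OF pr(1)] card_diff[OF pr(2)] by linarith
  moreover have "Re z = 0" "ceval c z \<noteq> 0" "cnj z \<in> T" if "z \<in> T" for z
    using that by (auto simp: T_def inner_zeros_def imaginary_zeros_def ceval_cnj inner_complex_def)
  ultimately obtain d where deg_d: "degree d \<le> degree c"
    and direction: "\<And>z. z \<in> imaginary_zeros c \<union> T \<Longrightarrow>
      \<exists>t::real. ceval d z = (v z - z ^ n) + of_real t * ceval c z"
    using positive_real_direction_exists[OF pr(1) \<open>c \<noteq> 0\<close> \<open>finite T\<close>, of "\<lambda>z. v z - z ^ n"] v_cnj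
    by blast
  have "\<forall>\<^sub>F e in at_right 0. SPR (c + smult e (monom 1 n + d)) x" if x: "x \<in> {a, b}" for x
  proof -
    have "degree x = n" using x deg by (auto simp: n_def)
    moreover have "inner_zeros c x \<subseteq> imaginary_zeros c \<union> T" using x by (auto simp: T_def)
    ultimately show ?thesis
      using eventually_SPR_perturbation[of c x d v] x pr \<open>c \<noteq> 0\<close> lead deg_d direction v_pos by blast
  qed
  then have "\<forall>\<^sub>F e in at_right 0. SPR (c + smult e (monom 1 n + d)) a \<and>
      SPR (c + smult e (monom 1 n + d)) b"
    by (intro eventually_conj) auto
  then show ?thesis using that eventually_happens by force
qed

section \<open>The segment\<close>

definition segment_poly :: "real poly \<Rightarrow> real poly \<Rightarrow> real \<Rightarrow> real poly" where
  "segment_poly a b l = smult l b + smult (1 - l) a"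

lemma ceval_segment_poly:
  "ceval (segment_poly a b l) z = (1 - l) *\<^sub>R ceval a z + l *\<^sub>R ceval b z"
  by (simp add: segment_poly_def scaleR_conv_of_real)

lemma segment_poly_monic:
  assumes "degree a = n" "lead_coeff a = 1" "degree b = n" "lead_coeff b = 1"
  shows "degree (segment_poly a b l) = n" "lead_coeff (segment_poly a b l) = 1"
proof -
  have "degree (segment_poly a b l) \<le> n"
    unfolding segment_poly_def using assms
    by (intro degree_add_le order.trans[OF degree_smult_le]) auto
  moreover have "coeff (segment_poly a b l) n = 1"
    using assms by (simp add: segment_poly_def)
  ultimately show "degree (segment_poly a b l) = n" by (simp add: antisym le_degree)
  then show "lead_coeff (segment_poly a b l) = 1"
    using \<open>coeff (segment_poly a b l) n = 1\<close> by simp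
qed

lemma SPR_common_imp_hurwitz_stable_segment:
  assumes "SPR c a" "SPR c b" "0 \<le> l" "l \<le> 1"
  shows "hurwitz_stable (segment_poly a b l)"
  unfolding hurwitz_stable_iff_ceval
proof (intro allI impI)
  fix z assume "Re z \<ge> 0"
  then have "ceval c z \<bullet> ceval a z > 0" "ceval c z \<bullet> ceval b z > 0"
    using assms(1,2) SPR_inner_pos_right_half_plane by blast+
  then have "(1 - l) * (ceval c z \<bullet> ceval a z) + l * (ceval c z \<bullet> ceval b z) > 0"
    using assms(3,4) by (cases "l = 0") (auto intro!: add_nonneg_pos mult_nonneg_nonneg)
  then show "ceval (segment_poly a b l) z \<noteq> 0"
    by (auto simp: ceval_segment_poly simp flip: inner_scaleR_right inner_add_right)
qed

lemma zero_notin_closed_segment_if_hurwitz_stable: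
  assumes stable: "\<And>t. 0 \<le> t \<Longrightarrow> t \<le> 1 \<Longrightarrow> hurwitz_stable (segment_poly a b t)"
    and l: "0 \<le> l" "l \<le> 1" and z: "Re z = 0"
  shows "0 \<notin> closed_segment (ceval a z) (ceval (segment_poly a b l) z)"
proof
  assume "0 \<in> closed_segment (ceval a z) (ceval (segment_poly a b l) z)"
  then obtain u where u: "0 \<le> u" "u \<le> 1"
    "0 = (1 - u) *\<^sub>R ceval a z + u *\<^sub>R ceval (segment_poly a b l) z"
    unfolding in_segment(1) by blast
  then have "ceval (segment_poly a b (u * l)) z = 0"
    by (simp add: ceval_segment_poly algebra_simps)
  moreover have "0 \<le> u * l" "u * l \<le> 1" using u l by (auto simp: mult_le_one)
  ultimately show False using stable z by (force simp: hurwitz_stable_iff_ceval)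
qed

lemma normalized_poly_convergent_subsequence:
  fixes p :: "nat \<Rightarrow> real poly"
  assumes deg: "\<And>k. degree (p k) \<le> n" and nz: "\<And>k. p k \<noteq> 0"
  obtains r s q where "strict_mono (r :: nat \<Rightarrow> nat)" "\<And>k. s k > 0" "q \<noteq> 0" "degree q \<le> n"
    "\<And>i. (\<lambda>k. coeff (smult (s k) (p (r k))) i) \<longlonglongrightarrow> coeff q i"
proof -
  define N where "N k = (\<Sum>i\<le>n. \<bar>coeff (p k) i\<bar>)" for k
  have N_pos: "N k > 0" for k
    unfolding N_def using nz[of k] deg[of k] by (intro sum_pos2[of _ "degree (p k)"]) auto
  define f where "f k i = coeff (smult (inverse (N k)) (p k)) i" for k i
  have f_sum: "(\<Sum>i\<le>n. \<bar>f k i\<bar>) = 1" for k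
    using N_pos[of k] by (simp add: f_def abs_mult N_def[symmetric] flip: sum_distrib_left)
  have "norm (f k i) \<le> 1" if "i \<in> {..n}" for k i
    using member_le_sum[of i "{..n}" "\<lambda>i. \<bar>f k i\<bar>"] that f_sum[of k] by auto
  from function_convergent_subsequence[of "{..n}" f 1, OF countable_finite[OF finite_atMost] this]
  obtain r where subseq: "strict_mono r" "\<And>i. i \<in> {..n} \<Longrightarrow> \<exists>l. (\<lambda>k. f (r k) i) \<longlonglongrightarrow> l"
    by blast
  then obtain L where lim: "\<And>i. i \<le> n \<Longrightarrow> (\<lambda>k. f (r k) i) \<longlonglongrightarrow> L i"
    by (metis atMost_iff)
  define q where "q = (\<Sum>i\<le>n. monom (L i) i)"
  have coeff_q: "coeff q i = (if i \<le> n then L i else 0)" for i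
    by (auto simp: q_def coeff_sum)
  have "(\<lambda>k. \<Sum>i\<le>n. \<bar>f (r k) i\<bar>) \<longlonglongrightarrow> (\<Sum>i\<le>n. \<bar>L i\<bar>)"
    by (intro tendsto_intros lim) auto
  then have "(\<Sum>i\<le>n. \<bar>L i\<bar>) = 1" by (simp add: f_sum LIMSEQ_const_iff)
  then obtain i where "i \<le> n" "L i \<noteq> 0" by (force intro: ccontr)
  then have "q \<noteq> 0" using coeff_q[of i] by auto
  moreover have "degree q \<le> n" by (rule degree_le) (simp add: coeff_q)
  moreover have "(\<lambda>k. coeff (smult (inverse (N (r k))) (p (r k))) i) \<longlonglongrightarrow> coeff q i" for i
  proof (cases "i \<le> n")
    case True
    then show ?thesis using lim by (simp add: coeff_q f_def)
  next
    case False
    then have "coeff (p k) i = 0" for k using deg[of k] by (simp add: coeff_eq_0)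
    then show ?thesis using False by (simp add: coeff_q)
  qed
  ultimately show ?thesis
    using subseq(1) N_pos by (intro that[of r "\<lambda>k. inverse (N (r k))" q]) auto
qed

lemma tendsto_ceval:
  assumes "\<And>k. degree (p k) \<le> n" "degree q \<le> n" "\<And>i. (\<lambda>k. coeff (p k) i) \<longlonglongrightarrow> coeff q i"
  shows "(\<lambda>k. ceval (p k) z) \<longlonglongrightarrow> ceval q z"
  unfolding ceval_altdef[OF assms(1)] ceval_altdef[OF assms(2)]
  by (intro tendsto_intros assms(3))

lemma positive_real_common_limit:
  assumes SPR: "\<And>k. SPR (c k) a" "\<And>k. SPR (c k) (b k)"
    and lim: "\<And>z. (\<lambda>k. ceval (b k) z) \<longlonglongrightarrow> ceval b' z"
    and stable: "hurwitz_stable b'" and deg: "degree b' = degree a"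
  obtains q where "q \<noteq> 0" "positive_real q a" "positive_real q b'"
proof -
  have deg_c: "degree (c k) \<le> degree a" for k using SPR(1)[of k] by (simp add: SPR_def)
  have "c k \<noteq> 0" for k using SPR(1)[of k] by (auto simp: SPR_iff_inner_pos dest: spec[of _ 0])
  from normalized_poly_convergent_subsequence[of c, OF deg_c this] obtain r s q
    where subseq: "strict_mono r" and s_pos: "\<And>k. s k > 0" and "q \<noteq> 0"
      and deg_q: "degree q \<le> degree a"
      and coeff_lim: "\<And>i. (\<lambda>k. coeff (smult (s k) (c (r k))) i) \<longlonglongrightarrow> coeff q i"
    by blast
  have ceval_lim: "(\<lambda>k. ceval (smult (s k) (c (r k))) z) \<longlonglongrightarrow> ceval q z" for z
    by (rule tendsto_ceval[OF order.trans[OF degree_smult_le deg_c] deg_q coeff_lim])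
  have nonneg: "ceval q z \<bullet> w \<ge> 0"
    if "\<And>k. ceval (c k) z \<bullet> w' k > 0" "w' \<longlonglongrightarrow> w" for z w' w
  proof (rule LIMSEQ_le_const)
    show "(\<lambda>k. ceval (smult (s k) (c (r k))) z \<bullet> w' (r k)) \<longlonglongrightarrow> ceval q z \<bullet> w"
      using LIMSEQ_subseq_LIMSEQ[OF that(2) subseq]
      by (intro tendsto_inner ceval_lim) (simp add: o_def)
    show "\<exists>N. \<forall>k\<ge>N. 0 \<le> ceval (smult (s k) (c (r k))) z \<bullet> w' (r k)"
      using that(1) s_pos by (simp add: inner_mult_left less_imp_le)
  qed
  have "positive_real q a"
    using SPR(1) deg_q nonneg[OF _ tendsto_const] by (simp add: positive_real_def SPR_iff_inner_pos)
  moreover have "positive_real q b'"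
    using SPR(2) deg_q stable deg lim
    by (auto simp: positive_real_def SPR_iff_inner_pos intro!: nonneg)
  ultimately show ?thesis using \<open>q \<noteq> 0\<close> that by blast
qed

lemma SPR_segment_extend:
  assumes monic: "degree a = n" "lead_coeff a = 1" "degree b = n" "lead_coeff b = 1"
    and stable: "\<And>t. 0 \<le> t \<Longrightarrow> t \<le> 1 \<Longrightarrow> hurwitz_stable (segment_poly a b t)"
    and SPR: "SPR c (segment_poly a b l)" and l: "0 \<le> l" "l < 1"
  obtains u where "l < u" "u \<le> 1" "SPR c (segment_poly a b u)"
proof -
  have deg_c: "degree c = n" using SPR by (simp add: SPR_def segment_poly_monic[OF monic])
  have inner: "ceval (segment_poly a b l) z \<bullet> ceval c z > 0" if "Re z = 0" for z
    using SPR that by (simp add: SPR_iff_inner_pos inner_commute)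
  have shift: "segment_poly a b l + smult e (b - a) = segment_poly a b (l + e)" for e
    by (simp add: segment_poly_def poly_eq_iff algebra_simps)
  have "\<forall>\<^sub>F e in at_right 0. degree (segment_poly a b l + smult e (b - a)) = degree c \<and>
      (\<forall>z. Re z = 0 \<longrightarrow> ceval (segment_poly a b l + smult e (b - a)) z \<bullet> ceval c z > 0)"
  proof (rule eventually_poly_perturbation_inner_pos)
    show "coeff (b - a) (degree c) * lead_coeff c > 0" if "coeff (segment_poly a b l) (degree c) = 0"
      using that monic by (simp add: deg_c segment_poly_def)
    show "degree (b - a) \<le> degree c" using monic deg_c by (intro degree_diff_le) auto
    show "ceval c z \<noteq> 0" if "Re z = 0" for z using inner[OF that] by auto
    show "ceval (b - a) z \<bullet> ceval c z > 0"
      if "Re z = 0" "ceval (segment_poly a b l) z \<bullet> ceval c z = 0" for z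
      using that inner[of z] by simp
  qed (use inner deg_c segment_poly_monic(1)[OF monic] in \<open>simp_all add: less_imp_le\<close>)
  moreover have "\<forall>\<^sub>F e in at_right 0. e < 1 - l"
    using l by (intro order_tendstoD(2)[OF tendsto_ident_at]) simp
  ultimately have "\<forall>\<^sub>F e in at_right 0. l < l + e \<and> l + e \<le> 1 \<and> SPR c (segment_poly a b (l + e))"
    using eventually_at_right_less[of 0]
    by eventually_elim
      (use l stable in \<open>auto simp: shift SPR_iff_inner_pos inner_commute\<close>)
  then show ?thesis using that eventually_happens by force
qed

lemma closed_SPR_common_segment:
  assumes monic: "degree a = n" "lead_coeff a = 1" "degree b = n" "lead_coeff b = 1"
    and stable: "\<And>t. 0 \<le> t \<Longrightarrow> t \<le> 1 \<Longrightarrow> hurwitz_stable (segment_poly a b t)"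
  shows "closed {l \<in> {0..1}. \<exists>c. SPR c a \<and> SPR c (segment_poly a b l)}" (is "closed ?S")
  unfolding closed_sequential_limits
proof (intro allI impI, elim conjE)
  fix x l assume mem: "\<forall>k. x k \<in> ?S" and lim: "x \<longlonglongrightarrow> l"
  have l: "l \<in> {0..1}"
    using closed_sequentially[OF closed_atLeastAtMost _ lim] mem by auto
  from mem obtain c where "\<And>k. SPR (c k) a" "\<And>k. SPR (c k) (segment_poly a b (x k))"
    by simp metis
  moreover have "(\<lambda>k. ceval (segment_poly a b (x k)) z) \<longlonglongrightarrow> ceval (segment_poly a b l) z" for z
    unfolding ceval_segment_poly by (intro tendsto_intros lim)
  moreover have "hurwitz_stable (segment_poly a b l)" using stable l by simp
  moreover have "degree (segment_poly a b l) = degree a"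
    using segment_poly_monic(1)[OF monic] monic(1) by simp
  ultimately obtain q where "q \<noteq> 0" "positive_real q a" "positive_real q (segment_poly a b l)"
    by (rule positive_real_common_limit)
  then obtain c' where "SPR c' a" "SPR c' (segment_poly a b l)"
    using positive_real_common_imp_SPR_common[of q a "segment_poly a b l"]
      zero_notin_closed_segment_if_hurwitz_stable[OF stable] l segment_poly_monic[OF monic] monic
    by auto
  then show "l \<in> ?S" using l by auto
qed

lemma hurwitz_stable_segment_imp_SPR_common:
  assumes monic: "degree a = n" "lead_coeff a = 1" "degree b = n" "lead_coeff b = 1"
    and stable: "\<And>t. 0 \<le> t \<Longrightarrow> t \<le> 1 \<Longrightarrow> hurwitz_stable (segment_poly a b t)"
  obtains c where "SPR c a" "SPR c b"
proof -
  define S where "S = {l \<in> {0..1}. \<exists>c. SPR c a \<and> SPR c (segment_poly a b l)}"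
  have "SPR a a"
    using stable[of 0] by (auto simp: SPR_iff_inner_pos hurwitz_stable_iff_ceval segment_poly_def)
  then have "0 \<in> S" by (auto simp: S_def segment_poly_def)
  define m where "m = Sup S"
  have "bdd_above S" by (auto simp: S_def intro: bdd_aboveI[of _ 1])
  moreover have "closed S"
    unfolding S_def by (rule closed_SPR_common_segment[OF monic stable])
  ultimately have "m \<in> S"
    unfolding m_def using \<open>0 \<in> S\<close> by (intro closed_contains_Sup) auto
  then obtain c where SPR_m: "SPR c a" "SPR c (segment_poly a b m)" and m: "0 \<le> m" "m \<le> 1"
    by (auto simp: S_def)
  have "m = 1"
  proof (rule ccontr)
    assume "m \<noteq> 1"
    then obtain u where u: "m < u" "u \<le> 1" "SPR c (segment_poly a b u)"
      using SPR_segment_extend[OF monic stable SPR_m(2)] m by auto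
    then have "u \<in> S" using SPR_m(1) m by (auto simp: S_def)
    then have "u \<le> m" unfolding m_def using \<open>bdd_above S\<close> by (rule cSup_upper)
    then show False using u(1) by simp
  qed
  then show ?thesis using SPR_m that by (simp add: segment_poly_def)
qed

theorem theorem1:
  fixes a b :: "real poly" and n :: nat
  assumes "n \<ge> 1"
    and "degree a = n" and "lead_coeff a = 1"
    and "degree b = n" and "lead_coeff b = 1"
    and "hurwitz_stable a" and "hurwitz_stable b"
  shows "(\<exists>c :: real poly. SPR c a \<and> SPR c b) \<longleftrightarrow>
         (\<forall>l::real. 0 \<le> l \<and> l \<le> 1 \<longrightarrow>
            hurwitz_stable (smult l b + smult (1 - l) a) \<and>
            degree (smult l b + smult (1 - l) a) = n)"
  unfolding segment_poly_def[symmetric]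
proof
  assume "\<exists>c. SPR c a \<and> SPR c b"
  then show "\<forall>l. 0 \<le> l \<and> l \<le> 1 \<longrightarrow>
      hurwitz_stable (segment_poly a b l) \<and> degree (segment_poly a b l) = n"
    using SPR_common_imp_hurwitz_stable_segment segment_poly_monic(1)[OF assms(2-5)] by blast
next
  assume "\<forall>l. 0 \<le> l \<and> l \<le> 1 \<longrightarrow>
      hurwitz_stable (segment_poly a b l) \<and> degree (segment_poly a b l) = n"
  then show "\<exists>c. SPR c a \<and> SPR c b"
    using hurwitz_stable_segment_imp_SPR_common[OF assms(2-5)] by metis
qed

end
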